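(* Let $\ell_{\mathrm B}(p,y)=\frac12(p-y)^2$. There are a fixed domain $\mathcal X$, a fixed class $\mathcal H_\star$ of three hypotheses $\mathcal X\to[0,1]$, and constants $c>0$ and $T_0$ such that for every $T\ge T_0$, every grid size $N$, and every randomized online learner predicting on $\Gamma_N$ for $T$ rounds, $$\sup\ \mathbb E\,\mathrm{SwapReg}_T(\ell_{\mathrm B},\mathcal H_\star)\ \ge\ c\,T^{1/3},$$ where the supremum is over all nonanticipating environments generating $(x_t,y_t)_{t=1}^T$.
   Context: $\Gamma_N=\{0,1/N,\dots,1\}$. Online protocol: at round $t=1,\dots,T$, nature reveals $x_t\in\mathcal X$; the learner announces a distribution $\psi_t$ on $\Gamma_N$ (a function of the past transcript $(x_s,p_s,y_s)_{s<t}$ and of $x_t$); the learner privately draws $p_t\sim\psi_t$; nature reveals $y_t\in\{0,1\}$. The environment is adaptive and nonanticipating: $x_t$ and $y_t$ may depend arbitrarily (possibly randomly) on the past, and $y_t$ also on $x_t,\psi_t$, but $y_t$ cannot depend on the fresh draw $p_t$. Swap regret of a loss $\ell$ against a class $\mathcal H$ of functions $\mathcal X\to[0,1]$: $$\mathrm{SwapReg}_T(\ell,\mathcal H)=\sup_{\phi:\Gamma_N\to\mathcal H}\sum_{t=1}^T\big[\ell(p_t,y_t)-\ell(\phi(p_t)(x_t),y_t)\big].$$ *)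

theory Defs
  imports "HOL-Probability.Probability"
begin

definition grid :: "nat \<Rightarrow> real set" where
  "grid N = (\<lambda>k. real k / real N) ` {0..N}"

text \<open>Outcomes in \<open>{0,1}\<close> are booleans, embedded into the reals by \<^const>\<open>of_bool\<close>.
  Transcripts list the rounds \<open>(x\<^sub>t, p\<^sub>t, y\<^sub>t)\<close> in chronological order.\<close>

type_synonym 'x transcript = "('x \<times> real \<times> bool) list"

type_synonym 'x learner = "'x transcript \<Rightarrow> 'x \<Rightarrow> real pmf"

text \<open>An environment consists of the conditional law of \<open>x\<^sub>t\<close> given the past and the conditional
  law of \<open>y\<^sub>t\<close> given the past, \<open>x\<^sub>t\<close> and the announced distribution \<open>\<psi>\<^sub>t\<close>. The earlier announced
  distributions are determined by the learner and the transcript.\<close>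

type_synonym 'x environment =
  "('x transcript \<Rightarrow> 'x pmf) \<times> ('x transcript \<Rightarrow> 'x \<Rightarrow> real pmf \<Rightarrow> bool pmf)"

definition learners :: "nat \<Rightarrow> 'x learner set" where
  "learners N = {L. \<forall>h x. set_pmf (L h x) \<subseteq> grid N}"

definition environments :: "'x set \<Rightarrow> 'x environment set" where
  "environments X = {E. \<forall>h. set_pmf (fst E h) \<subseteq> X}"

text \<open>Nonanticipation: \<open>p\<^sub>t\<close> and \<open>y\<^sub>t\<close> are drawn independently given the past and \<open>x\<^sub>t\<close>.\<close>

primrec play :: "'x learner \<Rightarrow> 'x environment \<Rightarrow> nat \<Rightarrow> 'x transcript pmf" where
  "play L E 0 = return_pmf []"
| "play L E (Suc t) =
     bind_pmf (play L E t) (\<lambda>h.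
     bind_pmf (fst E h) (\<lambda>x.
     bind_pmf (L h x) (\<lambda>p.
     bind_pmf (snd E h x (L h x)) (\<lambda>y.
     return_pmf (h @ [(x, p, y)])))))"

definition brier :: "real \<Rightarrow> bool \<Rightarrow> real" where
  "brier p y = 1 / 2 * (p - of_bool y)\<^sup>2"

definition swap_regret ::
  "nat \<Rightarrow> (real \<Rightarrow> bool \<Rightarrow> real) \<Rightarrow> ('x \<Rightarrow> real) set \<Rightarrow> 'x transcript \<Rightarrow> real" where
  "swap_regret N loss H h =
     (SUP \<phi> \<in> grid N \<rightarrow>\<^sub>E H. \<Sum>(x, p, y)\<leftarrow>h. loss p y - loss (\<phi> p x) y)"

text \<open>For \<open>N \<ge> 1\<close>, a finite nonempty class of functions from \<open>X\<close> into the unit interval and the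
  Brier loss, the supremum above is over a finite nonempty set, and the regret over \<open>T\<close> rounds is
  bounded by \<open>T / 2\<close> in absolute value. So suprema of its expectation over environments may be
  taken in the reals.\<close>

definition expected_swap_regret ::
  "nat \<Rightarrow> (real \<Rightarrow> bool \<Rightarrow> real) \<Rightarrow> ('x \<Rightarrow> real) set \<Rightarrow> 'x learner \<Rightarrow> 'x environment \<Rightarrow> nat \<Rightarrow> real"
where
  "expected_swap_regret N loss H L E T =
     measure_pmf.expectation (play L E T) (swap_regret N loss H)"

end

theory Submission imports Defs begin

text \<open>
  Nature ignores the learner. The rate \<open>q\<^sub>t\<close> takes \<open>m \<approx> T\<^bsup>1/3\<^esup>\<close> equally spaced values, each for
  \<open>m\<^sup>2\<close> consecutive rounds; the context is \<open>(q\<^sub>t, q\<^sub>t + \<delta>, q\<^sub>t - \<delta>)\<close> with \<open>\<delta>\<close> of order \<open>1/m\<close>, the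
  outcome is Bernoulli with mean \<open>q\<^sub>t\<close>, and the hypotheses are the coordinates. Comparing every
  forecast value \<open>p\<close> with \<open>q \<plusminus> \<delta>\<close>, the sign being that of the residual \<open>S\<^sub>p = \<Sum> (y\<^sub>t - q\<^sub>t)\<close> over the
  rounds with \<open>p\<^sub>t = p\<close>, the swap regret is in expectation at least that of
  \<open>\<Sum>\<^sub>t ((p\<^sub>t - q\<^sub>t)\<^sup>2 - \<delta>\<^sup>2) / 2 + \<delta> \<Sum>\<^sub>p \<bar>S\<^sub>p\<bar>\<close>.

  It remains to see that each round contributes order \<open>\<delta>\<^sup>2\<close>, even though the learner may stop using
  \<open>p\<close> whenever \<open>S\<^sub>p\<close> is small. Replace \<open>\<bar>S\<^sub>p\<bar>\<close> by a multiple of \<open>1 - cos (\<eta> S\<^sub>p)\<close>, where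
  \<open>\<eta> = 32 \<delta> = 1 / (2 m)\<close>, times a weight growing by the factor \<open>1 + \<eta>\<^sup>2 / 4\<close> in every round with
  \<open>q\<^sub>t\<close> close to \<open>p\<close>. The weight makes the drift of this potential at least of order \<open>\<delta>\<^sup>2\<close> in close
  rounds, whatever \<open>S\<^sub>p\<close>, and stays below \<open>2\<close> because only one value of the rate is close to \<open>p\<close>.
  In the other rounds a negative drift is compensated by \<open>(p\<^sub>t - q\<^sub>t)\<^sup>2 / 2\<close>.
\<close>

section \<open>Cosine estimates and a tower inequality\<close>

lemma cos_add_taylor:
  fixes u z :: real
  shows "\<bar>cos (u + z) - (cos u - z * sin u - z\<^sup>2 / 2 * cos u)\<bar> \<le> \<bar>z\<bar> ^ 3 / 6"
proof -
  \<comment> \<open>\<open>D k\<close> is the k-th derivative of \<open>cos (u + z)\<close> in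
    \<open>z\<close>, again a shifted cosine and so bounded by 1.\<close>
  define D where "D k z = cos (u + z + real k * pi / 2)" for k z
  have "DERIV (D k) z :> D (Suc k) z" for k z
    unfolding D_def
    by (rule derivative_eq_intros refl | simp add: add_divide_distrib distrib_right
          cos_add sin_add)+
  then obtain t where "cos (u + z) = (\<Sum>k<3. D k 0 / fact k * z ^ k) + D 3 t / fact 3 * z ^ 3"
    using Maclaurin_all_le[of D "\<lambda>z. cos (u + z)" z 3] by (force simp: D_def)
  moreover have "(\<Sum>k<3. D k 0 / fact k * z ^ k) = cos u - z * sin u - z\<^sup>2 / 2 * cos u"
    by (simp add: D_def eval_nat_numeral cos_add sin_add)
  moreover have "\<bar>D 3 t / fact 3 * z ^ 3\<bar> \<le> \<bar>z\<bar> ^ 3 / 6"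
  proof -
    have "\<bar>D 3 t\<bar> * \<bar>z\<bar> ^ 3 \<le> 1 * \<bar>z\<bar> ^ 3"
      unfolding D_def by (intro mult_right_mono abs_cos_le_one) auto
    then show ?thesis by (simp add: abs_mult power_abs fact_numeral)
  qed
  ultimately show ?thesis by simp
qed

text \<open>The increment is centred, so the sine terms cancel; its variance
  \<open>q * (1 - q)\<close> gives the second-order term.\<close>

lemma bernoulli_cos_step:
  fixes q \<eta> u :: real
  assumes q: "0 \<le> q" "q \<le> 1" and \<eta>: "0 \<le> \<eta>"
  shows "q * cos (u + \<eta> * (1 - q)) + (1 - q) * cos (u - \<eta> * q)
           \<le> cos u * (1 - q * (1 - q) * \<eta>\<^sup>2 / 2) + \<eta> ^ 3 / 6"
proof -
  have step: "cos (u + \<eta> * z) \<le> cos u - \<eta> * z * sin u - (\<eta> * z)\<^sup>2 / 2 * cos u + \<eta> ^ 3 / 6"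
    if "\<bar>z\<bar> \<le> 1" for z
  proof -
    have "\<bar>\<eta> * z\<bar> ^ 3 \<le> \<eta> ^ 3"
      using that \<eta> by (intro power_mono) (auto simp: abs_mult intro: mult_left_le)
    then show ?thesis using cos_add_taylor[of u "\<eta> * z"] by linarith
  qed
  have "q * cos (u + \<eta> * (1 - q)) + (1 - q) * cos (u + \<eta> * (- q))
    \<le> q * (cos u - \<eta> * (1 - q) * sin u - (\<eta> * (1 - q))\<^sup>2 / 2 * cos u + \<eta> ^ 3 / 6)
      + (1 - q) * (cos u - \<eta> * (- q) * sin u - (\<eta> * (- q))\<^sup>2 / 2 * cos u + \<eta> ^ 3 / 6)"
    using q by (intro add_mono mult_left_mono step) auto
  also have "\<dots> = cos u * (1 - q * (1 - q) * \<eta>\<^sup>2 / 2) + \<eta> ^ 3 / 6"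
    by (simp add: field_simps power2_eq_square)
  finally show ?thesis by simp
qed

lemma one_minus_cos_le_abs: "1 - cos u \<le> \<bar>u :: real\<bar>"
proof -
  have "1 - cos u = 2 * (\<bar>sin (u / 2)\<bar> * \<bar>sin (u / 2)\<bar>)"
    using cos_double_sin[of "u / 2"] by (simp add: power2_eq_square flip: abs_mult)
  also have "\<dots> \<le> 2 * (\<bar>u / 2\<bar> * 1)"
    by (intro mult_left_mono mult_mono abs_sin_x_le_abs_x abs_sin_le_one) auto
  finally show ?thesis by simp
qed

lemma expectation_bind_ge:
  fixes f :: "'b \<Rightarrow> real"
  assumes "finite (set_pmf P)" "\<And>a. a \<in> set_pmf P \<Longrightarrow> finite (set_pmf (K a))"
    and "\<And>a. a \<in> set_pmf P \<Longrightarrow> g a \<le> measure_pmf.expectation (K a) f"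
  shows "measure_pmf.expectation P g \<le> measure_pmf.expectation (bind_pmf P K) f"
proof -
  have "measure_pmf.expectation P g = (\<Sum>a\<in>set_pmf P. pmf P a * g a)"
    using assms(1) by (subst integral_measure_pmf[of "set_pmf P"]) auto
  also have "\<dots> \<le> (\<Sum>a\<in>set_pmf P. pmf P a * measure_pmf.expectation (K a) f)"
    by (intro sum_mono mult_left_mono assms) auto
  also have "\<dots> = measure_pmf.expectation (bind_pmf P K) f"
    using assms by (subst pmf_expectation_bind[of "set_pmf P"]) auto
  finally show ?thesis .
qed


section \<open>Transcripts and an upper bound for the regret\<close>

lemma finite_grid: "finite (grid N)"
  by (simp add: grid_def)

lemma grid_subset_unit: "grid N \<subseteq> {0..1}"
  by (cases "N = 0") (auto simp: grid_def divide_simps)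

lemma length_play: "h \<in> set_pmf (play L E t) \<Longrightarrow> length h = t"
  by (induction t arbitrary: h) auto

lemma play_forecast_in_grid:
  assumes "L \<in> learners N" "h \<in> set_pmf (play L E t)" "(x, p, y) \<in> set h"
  shows "p \<in> grid N"
  using assms(2,3)
proof (induction t arbitrary: h)
  case (Suc t)
  then show ?case using assms(1) by (fastforce simp: learners_def)
qed simp

lemma swap_regret_le:
  assumes H: "H \<noteq> {}" and h: "\<And>x p y. (x, p, y) \<in> set h \<Longrightarrow> p \<in> grid N"
  shows "swap_regret N brier H h \<le> real (length h) / 2"
  unfolding swap_regret_def
proof (rule cSUP_least)
  show "grid N \<rightarrow>\<^sub>E H \<noteq> {}"
    using H by (auto simp: PiE_eq_empty_iff)
  fix \<phi>
  have term_le: "brier p y - brier (\<phi> p x) y \<le> 1 / 2" if "(x, p, y) \<in> set h" for x p y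
  proof -
    have "\<bar>p - of_bool y\<bar> \<le> 1"
      using h[OF that] grid_subset_unit[of N] by (cases y) auto
    then have "(p - of_bool y)\<^sup>2 \<le> 1"
      by (simp add: abs_square_le_1)
    moreover have "0 \<le> (\<phi> p x - of_bool y)\<^sup>2" by simp
    ultimately show ?thesis unfolding brier_def by linarith
  qed
  have "(\<Sum>(x, p, y)\<leftarrow>h. brier p y - brier (\<phi> p x) y) \<le> (\<Sum>_\<leftarrow>h. 1 / 2)"
    by (rule sum_list_mono) (use term_le in auto)
  then show "(\<Sum>(x, p, y)\<leftarrow>h. brier p y - brier (\<phi> p x) y) \<le> real (length h) / 2"
    by (simp add: sum_list_triv)
qed

text \<open>Makes the supremum over environments bounded above, so that any single environment
  bounds it from below.\<close>

lemma expected_swap_regret_le: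
  assumes "L \<in> learners N" and H: "H \<noteq> {}"
  shows "expected_swap_regret N brier H L E T \<le> real T / 2"
proof (cases "integrable (measure_pmf (play L E T)) (swap_regret N brier H)")
  case True
  have "swap_regret N brier H h \<le> real T / 2" if "h \<in> set_pmf (play L E T)" for h
    using swap_regret_le[OF H, of h N] play_forecast_in_grid[OF assms(1) that]
      length_play[OF that] by auto
  then show ?thesis
    unfolding expected_swap_regret_def
    by (intro measure_pmf.integral_le_const True) (simp add: AE_measure_pmf_iff)
\<comment> \<open>A nonintegrable regret has expectation 0 by convention, which meets the bound
  too.\<close>
qed (simp add: expected_swap_regret_def not_integrable_integral_eq)

section \<open>Swap regret in terms of residuals\<close>

definition residual :: "real \<Rightarrow> (real \<times> real \<times> real) transcript \<Rightarrow> real" where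
  "residual p h = (\<Sum>(x, p', y)\<leftarrow>h. if p' = p then of_bool y - fst x else 0)"

text \<open>With \<open>z = y - q\<close>, the Brier regret against \<open>q + s\<close> is
  \<open>(p - q)\<^sup>2 / 2 - (p - q) * z - s\<^sup>2 / 2 + s * z\<close>. For
  \<open>s = \<plusminus>\<delta>\<close> only the last term depends on the sign; it is left out
  here.\<close>

definition excess :: "real \<Rightarrow> (real \<times> real \<times> real) transcript \<Rightarrow> real" where
  "excess \<delta> h =
     (\<Sum>(x, p, y)\<leftarrow>h. (p - fst x)\<^sup>2 / 2 - (p - fst x) * (of_bool y - fst x) - \<delta>\<^sup>2 / 2)"

lemma residual_simps [simp]:
  "residual p [] = 0"
  "residual p (h @ [(x, p', y)]) =
     residual p h + (if p' = p then of_bool y - fst x else 0)"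
  "residual p ((x, p', y) # h) =
     (if p' = p then of_bool y - fst x else 0) + residual p h"
  by (simp_all add: residual_def)

lemma excess_simps [simp]:
  "excess \<delta> [] = 0"
  "excess \<delta> (h @ [(x, p, y)]) = excess \<delta> h +
     ((p - fst x)\<^sup>2 / 2 - (p - fst x) * (of_bool y - fst x) - \<delta>\<^sup>2 / 2)"
  by (simp_all add: excess_def)

lemma sum_list_by_forecast:
  assumes "finite G" "\<And>x p y. (x, p, y) \<in> set h \<Longrightarrow> p \<in> G"
  shows "(\<Sum>(x, p, y)\<leftarrow>h. c p * (of_bool y - fst x)) = (\<Sum>p\<in>G. c p * residual p h)"
  using assms(2)
proof (induction h)
  case (Cons a h)
  obtain x p y where a: "a = (x, p, y)" by (cases a) auto
  have "p \<in> G" using Cons.prems[of x p y] by (simp add: a)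
  have "(\<Sum>p'\<in>G. c p' * residual p' (a # h)) =
    (\<Sum>p'\<in>G. (if p = p' then c p' * (of_bool y - fst x) else 0) + c p' * residual p' h)"
    by (intro sum.cong) (auto simp: a algebra_simps)
  also have "\<dots> = c p * (of_bool y - fst x) + (\<Sum>p'\<in>G. c p' * residual p' h)"
    using \<open>finite G\<close> \<open>p \<in> G\<close> by (simp add: sum.distrib)
  also have "(\<Sum>p'\<in>G. c p' * residual p' h) = (\<Sum>(x, p, y)\<leftarrow>h. c p * (of_bool y - fst x))"
    by (rule Cons.IH[symmetric]) (use Cons.prems in \<open>meson list.set_intros(2)\<close>)
  finally show ?case by (simp add: a)
qed simp

text \<open>Swapping each forecast value to \<open>up\<close> or \<open>down\<close> by the sign of
  its residual turns the linear terms, regrouped by forecast value, into absolute residuals.\<close>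

lemma swap_regret_ge:
  assumes h: "\<And>x p y. (x, p, y) \<in> set h \<Longrightarrow> p \<in> grid N \<and> up x = fst x + \<delta> \<and> down x = fst x - \<delta>"
    and H: "finite H" "up \<in> H" "down \<in> H"
  shows "excess \<delta> h + (\<Sum>p\<in>grid N. \<delta> * \<bar>residual p h\<bar>) \<le> swap_regret N brier H h"
proof -
  define s :: "real \<Rightarrow> real" where "s p = (if residual p h \<ge> 0 then \<delta> else - \<delta>)" for p
  define \<phi> where "\<phi> = restrict (\<lambda>p. if residual p h \<ge> 0 then up else down) (grid N)"
  have \<phi>: "\<phi> \<in> grid N \<rightarrow>\<^sub>E H"
    using H by (auto simp: \<phi>_def)
  have term_eq: "brier p y - brier (\<phi> p x) y =
      ((p - fst x)\<^sup>2 / 2 - (p - fst x) * (of_bool y - fst x) - \<delta>\<^sup>2 / 2) + s p * (of_bool y - fst x)"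
    if "(x, p, y) \<in> set h" for x p y
  proof -
    have \<phi>: "\<phi> p x = fst x + s p" using h[OF that] by (simp add: \<phi>_def s_def)
    have \<delta>: "\<delta>\<^sup>2 = (s p)\<^sup>2" by (simp add: s_def)
    show ?thesis
      unfolding brier_def \<phi> \<delta> by (simp add: power2_eq_square field_simps)
  qed
  have "(\<Sum>(x, p, y)\<leftarrow>h. brier p y - brier (\<phi> p x) y) =
      (\<Sum>z\<leftarrow>h. (case z of (x, p, y) \<Rightarrow>
        (p - fst x)\<^sup>2 / 2 - (p - fst x) * (of_bool y - fst x) - \<delta>\<^sup>2 / 2) +
        (case z of (x, p, y) \<Rightarrow> s p * (of_bool y - fst x)))"
    by (intro arg_cong[where f = sum_list] map_cong refl) (use term_eq in auto)
  also have "\<dots> = excess \<delta> h + (\<Sum>p\<in>grid N. s p * residual p h)"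
    unfolding sum_list_addf excess_def
    by (subst sum_list_by_forecast[of "grid N" h s]) (use h finite_grid in auto)
  also have "(\<Sum>p\<in>grid N. s p * residual p h) = (\<Sum>p\<in>grid N. \<delta> * \<bar>residual p h\<bar>)"
    by (intro sum.cong) (auto simp: s_def)
  finally have "excess \<delta> h + (\<Sum>p\<in>grid N. \<delta> * \<bar>residual p h\<bar>) =
    (\<Sum>(x, p, y)\<leftarrow>h. brier p y - brier (\<phi> p x) y)" ..
  also have "\<dots> \<le> swap_regret N brier H h"
    unfolding swap_regret_def
    by (intro cSUP_upper \<phi> bdd_above_finite finite_imageI finite_PiE finite_grid H)
  finally show ?thesis .
qed

section \<open>The environment and the weighted potential\<close>

definition rate :: "nat \<Rightarrow> nat \<Rightarrow> real" where
  "rate m t = 1 / 4 + real (t div m\<^sup>2) / (2 * real m)"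

definition forecasts :: "nat \<Rightarrow> nat \<Rightarrow> real \<times> real \<times> real" where
  "forecasts m t = (rate m t, rate m t + 1 / (64 * real m), rate m t - 1 / (64 * real m))"

text \<open>Only the first \<open>m\<^sup>3\<close> rounds matter; the remainder keeps all contexts in the unit cube.\<close>

definition hard_env :: "nat \<Rightarrow> (real \<times> real \<times> real) environment" where
  "hard_env m =
     (\<lambda>h. return_pmf (forecasts m (length h mod m ^ 3)), \<lambda>h x \<psi>. bernoulli_pmf (fst x))"

lemma hard_env_simps [simp]:
  "fst (hard_env m) h = return_pmf (forecasts m (length h mod m ^ 3))"
  "snd (hard_env m) h x \<psi> = bernoulli_pmf (fst x)"
  by (simp_all add: hard_env_def)

text \<open>All rounds with a nearby rate count, whether or not the learner forecast \<open>p\<close> in them; so the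
  weight of \<open>p\<close> is deterministic.\<close>

definition close_rounds :: "nat \<Rightarrow> real \<Rightarrow> nat \<Rightarrow> nat" where
  "close_rounds m p t = card {i \<in> {..<t}. \<bar>p - rate m i\<bar> < 1 / (4 * real m)}"

text \<open>With \<open>\<eta> = 1 / (2 * m)\<close> the growth rate is
  \<open>\<eta>\<^sup>2 / 4\<close>. The weight is at most 2 and
  \<open>1 - cos z \<le> \<bar>z\<bar>\<close>, so the divisor 64 keeps each summand below
  \<open>1 / (64 * m)\<close> times the absolute residual.\<close>

definition potential ::
  "nat \<Rightarrow> nat \<Rightarrow> nat \<Rightarrow> (real \<times> real \<times> real) transcript \<Rightarrow> real" where
  "potential m N t h = excess (1 / (64 * real m)) h +
     (\<Sum>p\<in>grid N. (1 + 1 / (16 * (real m)\<^sup>2)) ^ close_rounds m p t *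
        (1 - cos (residual p h / (2 * real m))) / 64)"

text \<open>Keeps the Bernoulli variance at least 3/16 and the shifted rates in the unit
  interval.\<close>

lemma rate_bounds:
  assumes "t < m ^ 3"
  shows "1 / 4 \<le> rate m t" "rate m t \<le> 3 / 4"
proof -
  have "m > 0" using assms by (cases m) auto
  have "t div m\<^sup>2 < m"
    using assms by (intro less_mult_imp_div_less) (simp add: eval_nat_numeral mult_ac)
  then show "rate m t \<le> 3 / 4"
    using \<open>m > 0\<close> by (simp add: rate_def field_simps)
qed (simp add: rate_def)

text \<open>Rates of different blocks differ by at least \<open>1 / (2 * m)\<close>, twice the
  closeness radius, so all close rounds lie in one block.\<close>

lemma close_rounds_le:
  assumes "m > 0"
  shows "close_rounds m p t \<le> m\<^sup>2"
proof (cases "\<exists>i. \<bar>p - rate m i\<bar> < 1 / (4 * real m)")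
  case True
  then obtain i where i: "\<bar>p - rate m i\<bar> < 1 / (4 * real m)" by auto
  define k where "k = i div m\<^sup>2"
  have "j div m\<^sup>2 = k" if j: "\<bar>p - rate m j\<bar> < 1 / (4 * real m)" for j
  proof -
    have "\<bar>rate m j - rate m i\<bar> < 1 / (2 * real m)"
      using i j by (simp add: field_simps abs_if split: if_splits)
    moreover have "rate m j - rate m i = (real (j div m\<^sup>2) - real k) / (2 * real m)"
      by (simp add: rate_def k_def diff_divide_distrib)
    ultimately have "\<bar>real (j div m\<^sup>2) - real k\<bar> < 1"
      using assms by (simp add: divide_less_cancel)
    then show ?thesis by linarith
  qed
  moreover have "j div m\<^sup>2 * m\<^sup>2 \<le> j \<and> j < j div m\<^sup>2 * m\<^sup>2 + m\<^sup>2" for j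
  proof -
    have "j mod m\<^sup>2 < m\<^sup>2" using assms by simp
    then show ?thesis using div_mult_mod_eq[of j "m\<^sup>2"] by linarith
  qed
  ultimately have "{i \<in> {..<t}. \<bar>p - rate m i\<bar> < 1 / (4 * real m)} \<subseteq> {k * m\<^sup>2..<k * m\<^sup>2 + m\<^sup>2}"
    by fastforce
  then have "close_rounds m p t \<le> card {k * m\<^sup>2..<k * m\<^sup>2 + m\<^sup>2}"
    unfolding close_rounds_def by (intro card_mono) auto
  then show ?thesis by simp
qed (simp add: close_rounds_def)

text \<open>Compounding over at most \<open>m\<^sup>2\<close> rounds gives at most
  \<open>exp (1 / 16)\<close>.\<close>

lemma growth_le_2:
  assumes "m > 0"
  shows "(1 + 1 / (16 * (real m)\<^sup>2)) ^ close_rounds m p t \<le> 2"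
proof -
  have "(1 + 1 / (16 * (real m)\<^sup>2)) ^ close_rounds m p t \<le> (1 + 1 / (16 * (real m)\<^sup>2)) ^ m\<^sup>2"
    by (intro power_increasing close_rounds_le assms) auto
  also have "\<dots> \<le> exp (1 / (16 * (real m)\<^sup>2)) ^ m\<^sup>2"
    by (intro power_mono exp_ge_add_one_self) auto
  also have "\<dots> = exp (1 / 16)"
    using assms by (simp flip: exp_of_nat_mult)
  also have "\<dots> \<le> 2"
    using exp_bound[of "1 / 16"] by (simp add: power2_eq_square)
  finally show ?thesis .
qed

lemma close_rounds_Suc:
  "close_rounds m p (Suc t) =
     (if \<bar>p - rate m t\<bar> < 1 / (4 * real m) then Suc (close_rounds m p t) else close_rounds m p t)"
proof -
  have "{i \<in> {..<Suc t}. \<bar>p - rate m i\<bar> < 1 / (4 * real m)} =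
    (if \<bar>p - rate m t\<bar> < 1 / (4 * real m)
     then insert t {i \<in> {..<t}. \<bar>p - rate m i\<bar> < 1 / (4 * real m)}
     else {i \<in> {..<t}. \<bar>p - rate m i\<bar> < 1 / (4 * real m)})"
    by (auto simp: less_Suc_eq)
  then show ?thesis by (simp add: close_rounds_def)
qed

section \<open>Drift of the potential in one round\<close>

text \<open>Here \<open>u\<close> is the residual of the forecast value \<open>p\<close>, and \<open>R\<close>, \<open>R'\<close> are its weights before and
  after the round.\<close>

lemma cell_step:
  fixes q p u \<eta> R R' :: real
  assumes q: "1 / 4 \<le> q" "q \<le> 3 / 4" and \<eta>: "0 < \<eta>" "\<eta> \<le> 1 / 8"
    and R: "1 \<le> R" "R' \<le> 2"
    and R': "R' = (if \<bar>p - q\<bar> < \<eta> / 2 then R * (1 + \<eta>\<^sup>2 / 4) else R)"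
  shows "R * (1 - cos (\<eta> * u)) / 64 + \<eta>\<^sup>2 / 2048
    \<le> (p - q)\<^sup>2 / 2 - (\<eta> / 32)\<^sup>2 / 2
      + R' * (q * (1 - cos (\<eta> * (u + (1 - q)))) + (1 - q) * (1 - cos (\<eta> * (u - q)))) / 64"
proof -
  define W where "W = 1 - cos (\<eta> * u)"
  define v where "v = q * (1 - q)"
  define M where "M = q * (1 - cos (\<eta> * (u + (1 - q)))) + (1 - q) * (1 - cos (\<eta> * (u - q)))"
  have W: "0 \<le> W" "W \<le> 2"
    using cos_ge_minus_one[of "\<eta> * u"] by (auto simp: W_def)
  have "0 \<le> (q - 1 / 4) * (3 / 4 - q)" "0 \<le> (q - 1 / 2)\<^sup>2"
    using q by auto
  then have v: "3 / 16 \<le> v" "v \<le> 1 / 4"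
    unfolding v_def by (auto simp: field_simps power2_eq_square)
  \<comment> \<open>The Taylor error \<open>\<eta> ^ 3 / 6\<close> is thus at most
    \<open>\<eta>\<^sup>2 / 48\<close>, small against the variance term, which is at least
    \<open>3 * \<eta>\<^sup>2 / 32\<close>.\<close>
  have \<eta>3: "\<eta> ^ 3 \<le> \<eta>\<^sup>2 / 8"
    using \<eta> mult_left_mono[of \<eta> "1 / 8" "\<eta>\<^sup>2"] by (simp add: power3_eq_cube power2_eq_square)
  have \<eta>2: "0 < \<eta>\<^sup>2" "\<eta>\<^sup>2 \<le> 1"
    using \<eta> by (auto simp: power_le_one)
  have "M \<ge> 1 - (cos (\<eta> * u) * (1 - v * \<eta>\<^sup>2 / 2) + \<eta> ^ 3 / 6)"
    using bernoulli_cos_step[of q \<eta> "\<eta> * u"] q \<eta> by (simp add: M_def v_def algebra_simps)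
  moreover have "1 - cos (\<eta> * u) * (1 - v * \<eta>\<^sup>2 / 2) = W * (1 - v * \<eta>\<^sup>2 / 2) + v * \<eta>\<^sup>2 / 2"
    by (simp add: W_def field_simps)
  ultimately have M: "M \<ge> W * (1 - v * \<eta>\<^sup>2 / 2) + v * \<eta>\<^sup>2 / 2 - \<eta>\<^sup>2 / 48"
    using \<eta>3 by linarith
  have v\<eta>: "3 / 16 * \<eta>\<^sup>2 \<le> v * \<eta>\<^sup>2" "v * \<eta>\<^sup>2 \<le> 1 / 4 * \<eta>\<^sup>2"
    using v \<eta>2 by (auto intro: mult_right_mono)
  have "R * W / 64 + \<eta>\<^sup>2 / 2048 \<le> (p - q)\<^sup>2 / 2 - (\<eta> / 32)\<^sup>2 / 2 + R' * M / 64"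
  proof (cases "\<bar>p - q\<bar> < \<eta> / 2")
    case True
    \<comment> \<open>As \<open>v \<le> 1 / 4\<close>, the factor on \<open>W\<close> is at least
      \<open>1 - \<eta>\<^sup>2 / 8\<close>; the growth of the weight makes up for this
      loss.\<close>
    have "0 \<le> \<eta>\<^sup>2 * (4 - \<eta>\<^sup>2) / 32"
      using \<eta>2 by auto
    also have "\<dots> = (1 + \<eta>\<^sup>2 / 4) * (1 - \<eta>\<^sup>2 / 8) - 1"
      by (simp add: field_simps)
    finally have "1 \<le> (1 + \<eta>\<^sup>2 / 4) * (1 - \<eta>\<^sup>2 / 8)"
      by simp
    also have "\<dots> \<le> (1 + \<eta>\<^sup>2 / 4) * (1 - v * \<eta>\<^sup>2 / 2)"
      using v\<eta> \<eta>2 by (intro mult_left_mono) auto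
    finally have "W * 1 \<le> W * ((1 + \<eta>\<^sup>2 / 4) * (1 - v * \<eta>\<^sup>2 / 2))"
      using W by (intro mult_left_mono) auto
    moreover have "\<eta>\<^sup>2 / 16 \<le> (1 + \<eta>\<^sup>2 / 4) * (v * \<eta>\<^sup>2 / 2 - \<eta>\<^sup>2 / 48)"
    proof -
      have "\<eta>\<^sup>2 / 16 \<le> v * \<eta>\<^sup>2 / 2 - \<eta>\<^sup>2 / 48"
        using v\<eta> \<eta>2 by linarith
      then have "1 * (\<eta>\<^sup>2 / 16) \<le> (1 + \<eta>\<^sup>2 / 4) * (v * \<eta>\<^sup>2 / 2 - \<eta>\<^sup>2 / 48)"
        by (intro mult_mono) auto
      then show ?thesis by simp
    qed
    moreover have "(1 + \<eta>\<^sup>2 / 4) * (W * (1 - v * \<eta>\<^sup>2 / 2) + v * \<eta>\<^sup>2 / 2 - \<eta>\<^sup>2 / 48) \<le> (1 + \<eta>\<^sup>2 / 4) * M"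
      using M \<eta>2 by (intro mult_left_mono) auto
    moreover have "K * (W * a + b - c) = W * (K * a) + K * (b - c)" for K a b c
      by (simp add: algebra_simps)
    ultimately have "W + \<eta>\<^sup>2 / 16 \<le> (1 + \<eta>\<^sup>2 / 4) * M"
      by simp
    then have "R * (W + \<eta>\<^sup>2 / 16) \<le> R * ((1 + \<eta>\<^sup>2 / 4) * M)"
      using R by (intro mult_left_mono) auto
    moreover have "1 * (\<eta>\<^sup>2 / 16) \<le> R * (\<eta>\<^sup>2 / 16)"
      using R \<eta>2 by (intro mult_right_mono) auto
    ultimately have "R * W + \<eta>\<^sup>2 / 16 \<le> R' * M"
      using True R' by (simp add: algebra_simps)
    moreover have "0 \<le> (p - q)\<^sup>2" by simp
    moreover have "(\<eta> / 32)\<^sup>2 = \<eta>\<^sup>2 / 1024" by (simp add: power_divide)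
    \<comment> \<open>After division by 64 the gain is \<open>\<eta>\<^sup>2 / 1024\<close>; half of
      it pays for \<open>(\<eta> / 32)\<^sup>2 / 2\<close>.\<close>
    ultimately show ?thesis by linarith
  next
    case False
    \<comment> \<open>A far forecast pays at least \<open>\<eta>\<^sup>2 / 8\<close>, which covers
      the possible loss \<open>\<eta>\<^sup>2 / 128\<close> of the cosine term and the remaining
      \<open>\<eta>\<^sup>2 / 1024\<close>.\<close>
    then have R'R: "R' = R" using R' by simp
    have "(\<eta> / 2)\<^sup>2 \<le> \<bar>p - q\<bar>\<^sup>2"
      using False \<eta> by (intro power_mono) auto
    then have far: "\<eta>\<^sup>2 / 4 \<le> (p - q)\<^sup>2" by (simp add: power_divide)
    have "W * (v * \<eta>\<^sup>2 / 2) \<le> 2 * (v * \<eta>\<^sup>2 / 2)"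
      using W v\<eta> \<eta>2 by (intro mult_right_mono) auto
    moreover have "W * (1 - v * \<eta>\<^sup>2 / 2) = W - W * (v * \<eta>\<^sup>2 / 2)"
      by (simp add: right_diff_distrib)
    ultimately have "W - \<eta>\<^sup>2 / 4 \<le> M" using M v\<eta> \<eta>2 by linarith
    then have "R * (W - \<eta>\<^sup>2 / 4) \<le> R * M"
      using R by (intro mult_left_mono) auto
    moreover have "R * (\<eta>\<^sup>2 / 4) \<le> 2 * (\<eta>\<^sup>2 / 4)"
      using R R'R \<eta>2 by (intro mult_right_mono) auto
    ultimately have "R * W - \<eta>\<^sup>2 / 2 \<le> R' * M"
      by (simp add: R'R algebra_simps)
    moreover have "(\<eta> / 32)\<^sup>2 = \<eta>\<^sup>2 / 1024" by (simp add: power_divide)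
    ultimately show ?thesis using far \<eta>2 by linarith
  qed
  then show ?thesis by (simp add: W_def M_def)
qed

text \<open>Only the residual of \<open>p\<close> changes; the summands of other grid points cannot
  decrease, as their weights do not and \<open>1 - cos\<close> is nonnegative. So
  \<open>cell_step\<close> applies, with \<open>\<eta> = 1 / (2 * m)\<close>.\<close>

lemma potential_step:
  assumes m: "4 \<le> m" and t: "t < m ^ 3" and p: "p \<in> grid N"
    and q: "q = rate m t" and x: "fst x = q"
  shows "potential m N t h + 1 / (8192 * (real m)\<^sup>2)
    \<le> potential m N (Suc t) (h @ [(x, p, True)]) * q
      + potential m N (Suc t) (h @ [(x, p, False)]) * (1 - q)"
proof -
  define \<eta> where "\<eta> = 1 / (2 * real m)"
  define R where "R p t = (1 + 1 / (16 * (real m)\<^sup>2)) ^ close_rounds m p t" for p t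
  define C where "C t p u = R p t * (1 - cos (u / (2 * real m))) / 64" for t p u
  define B where "B = (\<Sum>p'\<in>grid N - {p}. C t p' (residual p' h))"
  define e where "e = excess (1 / (64 * real m)) h"
  define u where "u = residual p h"
  have qb: "1 / 4 \<le> q" "q \<le> 3 / 4" using rate_bounds[OF t] q by auto
  have "potential m N t h = e + (C t p u + B)"
    unfolding potential_def B_def e_def u_def
    by (subst sum.remove[OF finite_grid p]) (simp add: C_def R_def)
  moreover have new: "potential m N (Suc t) (h @ [(x, p, y)]) \<ge>
    e + ((p - q)\<^sup>2 / 2 - (p - q) * (of_bool y - q) - (1 / (64 * real m))\<^sup>2 / 2)
      + (C (Suc t) p (u + (of_bool y - q)) + B)" for y
  proof -
    have "C t p' z \<le> C (Suc t) p' z" for p' z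
      unfolding C_def R_def
      by (intro divide_right_mono mult_right_mono power_increasing) (auto simp: close_rounds_Suc)
    then have "B \<le> (\<Sum>p'\<in>grid N - {p}. C (Suc t) p' (residual p' (h @ [(x, p, y)])))"
      unfolding B_def by (intro sum_mono) auto
    then show ?thesis
      unfolding potential_def e_def u_def
      by (subst sum.remove[OF finite_grid p]) (simp add: C_def R_def x)
  qed
  have "C t p u + 1 / (8192 * (real m)\<^sup>2) \<le> (p - q)\<^sup>2 / 2 - (1 / (64 * real m))\<^sup>2 / 2
     + (q * C (Suc t) p (u + (1 - q)) + (1 - q) * C (Suc t) p (u - q))"
  proof -
    have "R p t * (1 - cos (\<eta> * u)) / 64 + \<eta>\<^sup>2 / 2048
      \<le> (p - q)\<^sup>2 / 2 - (\<eta> / 32)\<^sup>2 / 2 + R p (Suc t) *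
        (q * (1 - cos (\<eta> * (u + (1 - q)))) + (1 - q) * (1 - cos (\<eta> * (u - q)))) / 64"
    proof (rule cell_step[OF qb])
      show "0 < \<eta>" "\<eta> \<le> 1 / 8" using m by (auto simp: \<eta>_def field_simps)
      show "1 \<le> R p t" by (simp add: R_def)
      show "R p (Suc t) \<le> 2" unfolding R_def using m by (intro growth_le_2) auto
      show "R p (Suc t) = (if \<bar>p - q\<bar> < \<eta> / 2 then R p t * (1 + \<eta>\<^sup>2 / 4) else R p t)"
        by (simp add: R_def close_rounds_Suc q \<eta>_def power_divide power_mult_distrib)
    qed
    moreover have C: "C t' p z = R p t' * (1 - cos (\<eta> * z)) / 64" for t' z
      by (simp add: C_def \<eta>_def)
    moreover have "1 / (8192 * (real m)\<^sup>2) = \<eta>\<^sup>2 / 2048" "1 / (64 * real m) = \<eta> / 32"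
      by (simp_all add: \<eta>_def power_divide power_mult_distrib)
    ultimately show ?thesis
      by (simp only: C) (simp add: algebra_simps add_divide_distrib diff_divide_distrib)
  qed
  moreover have "potential m N (Suc t) (h @ [(x, p, True)]) * q
      + potential m N (Suc t) (h @ [(x, p, False)]) * (1 - q) \<ge>
    (e + ((p - q)\<^sup>2 / 2 - (p - q) * (1 - q) - (1 / (64 * real m))\<^sup>2 / 2)
      + (C (Suc t) p (u + (1 - q)) + B)) * q +
    (e + ((p - q)\<^sup>2 / 2 - (p - q) * (0 - q) - (1 / (64 * real m))\<^sup>2 / 2)
      + (C (Suc t) p (u + (0 - q)) + B)) * (1 - q)"
    using new[of True] new[of False] qb by (intro add_mono mult_right_mono) auto
  \<comment> \<open>The terms \<open>(p - q) * (y - q)\<close> average to zero over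
    \<open>y\<close>.\<close>
  moreover have "(e + ((p - q)\<^sup>2 / 2 - (p - q) * (1 - q) - D) + (C\<^sub>1 + B)) * q +
      (e + ((p - q)\<^sup>2 / 2 - (p - q) * (0 - q) - D) + (C\<^sub>0 + B)) * (1 - q) =
    e + B + ((p - q)\<^sup>2 / 2 - D + (q * C\<^sub>1 + (1 - q) * C\<^sub>0))" for C\<^sub>0 C\<^sub>1 D
    by (simp add: field_simps)
  ultimately show ?thesis by simp
qed

section \<open>Expectation over the play\<close>

lemma finite_set_pmf_learner:
  assumes "L \<in> learners N"
  shows "finite (set_pmf (L h x))"
proof (rule finite_subset[OF _ finite_grid])
  show "set_pmf (L h x) \<subseteq> grid N" using assms unfolding learners_def by blast
qed

lemma finite_play_hard_env:
  assumes "L \<in> learners N"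
  shows "finite (set_pmf (play L (hard_env m) t))"
  by (induction t) (simp_all add: finite_set_pmf_learner[OF assms])

lemma play_hard_env_contexts:
  assumes "m > 0" "h \<in> set_pmf (play L (hard_env m) t)" "(x, p, y) \<in> set h"
  shows "\<exists>i<m ^ 3. x = forecasts m i"
  using assms(2,3)
proof (induction t arbitrary: h)
  case (Suc t)
  from Suc.prems(1) obtain h' p' y' where h': "h' \<in> set_pmf (play L (hard_env m) t)"
    "h = h' @ [(forecasts m (length h' mod m ^ 3), p', y')]"
    by auto
  have "length h' mod m ^ 3 < m ^ 3" using assms(1) by simp
  moreover have "x = forecasts m (length h' mod m ^ 3) \<or> (x, p, y) \<in> set h'"
    using Suc.prems(2) h'(2) by auto
  ultimately show ?case using Suc.IH[OF h'(1)] by metis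
qed simp

text \<open>The drift bound holds for each single forecast, hence for every announced law, because
  the outcome is drawn independently of the forecast.\<close>

lemma expectation_potential_ge:
  assumes m: "4 \<le> m" and L: "L \<in> learners N" and "t \<le> m ^ 3"
  shows "real t / (8192 * (real m)\<^sup>2)
    \<le> measure_pmf.expectation (play L (hard_env m) t) (potential m N t)"
  using assms(3)
proof (induction t)
  case 0
  then show ?case by (simp add: potential_def)
next
  case (Suc t)
  let ?\<kappa> = "1 / (8192 * (real m)\<^sup>2)"
  have fin: "finite (set_pmf (play L (hard_env m) t))"
    by (rule finite_play_hard_env[OF L])
  note finL = finite_set_pmf_learner[OF L]
  have "real (Suc t) / (8192 * (real m)\<^sup>2)
    \<le> measure_pmf.expectation (play L (hard_env m) t) (\<lambda>h. potential m N t h + ?\<kappa>)"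
    using Suc fin by (simp add: integrable_measure_pmf_finite add_divide_distrib)
  also have "\<dots> \<le> measure_pmf.expectation (play L (hard_env m) (Suc t)) (potential m N (Suc t))"
    unfolding play.simps
  proof (rule expectation_bind_ge[OF fin], goal_cases)
    case 1
    then show ?case using finL by simp
  next
    case (2 h)
    then have h: "length h = t" by (rule length_play)
    have "potential m N t h + ?\<kappa> =
      measure_pmf.expectation (L h (forecasts m t)) (\<lambda>p. potential m N t h + ?\<kappa>)"
      by simp
    also have "\<dots> \<le> measure_pmf.expectation
      (L h (forecasts m t) \<bind> (\<lambda>p.
        bernoulli_pmf (rate m t) \<bind> (\<lambda>y. return_pmf (h @ [(forecasts m t, p, y)]))))
      (potential m N (Suc t))"
    proof (rule expectation_bind_ge[OF finL], goal_cases)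
      case (2 p)
      then have "p \<in> grid N" using L unfolding learners_def by blast
      have "0 \<le> rate m t" "rate m t \<le> 1" using rate_bounds[of t m] Suc.prems by auto
      then have "measure_pmf.expectation
          (bernoulli_pmf (rate m t) \<bind> (\<lambda>y. return_pmf (h @ [(forecasts m t, p, y)])))
          (potential m N (Suc t))
        = potential m N (Suc t) (h @ [(forecasts m t, p, True)]) * rate m t
          + potential m N (Suc t) (h @ [(forecasts m t, p, False)]) * (1 - rate m t)"
        by (simp flip: map_pmf_def)
      then show ?case
        using potential_step[OF m _ \<open>p \<in> grid N\<close> refl, of t "forecasts m t" h] Suc.prems
        by (simp add: forecasts_def)
    qed simp
    \<comment> \<open>Since \<open>t < m ^ 3\<close>, the \<open>mod\<close> in the environment
      returns \<open>t\<close>.\<close>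
    finally show ?case using Suc.prems by (simp add: bind_return_pmf h forecasts_def)
  qed
  finally show ?case .
qed

text \<open>Holds on every path: \<open>growth_le_2\<close> and \<open>one_minus_cos_le_abs\<close>
  lead from cosines back to absolute residuals.\<close>

lemma potential_le_swap_regret:
  assumes m: "m > 0" and L: "L \<in> learners N" and h: "h \<in> set_pmf (play L (hard_env m) t)"
    and H: "finite H" "up \<in> H" "down \<in> H"
    and hyp: "\<And>i. i < m ^ 3 \<Longrightarrow> up (forecasts m i) = rate m i + 1 / (64 * real m)"
      "\<And>i. i < m ^ 3 \<Longrightarrow> down (forecasts m i) = rate m i - 1 / (64 * real m)"
  shows "potential m N t h \<le> swap_regret N brier H h"
proof -
  have "(1 + 1 / (16 * (real m)\<^sup>2)) ^ close_rounds m p t * (1 - cos (residual p h / (2 * real m))) / 64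
     \<le> 1 / (64 * real m) * \<bar>residual p h\<bar>" for p
  proof -
    have "(1 + 1 / (16 * (real m)\<^sup>2)) ^ close_rounds m p t * (1 - cos (residual p h / (2 * real m)))
      \<le> 2 * \<bar>residual p h / (2 * real m)\<bar>"
      by (intro mult_mono growth_le_2 m one_minus_cos_le_abs) auto
    then show ?thesis by (simp add: abs_mult)
  qed
  then have "potential m N t h \<le> excess (1 / (64 * real m)) h +
     (\<Sum>p\<in>grid N. 1 / (64 * real m) * \<bar>residual p h\<bar>)"
    unfolding potential_def by (intro add_left_mono sum_mono)
  also have "\<dots> \<le> swap_regret N brier H h"
  proof (rule swap_regret_ge[OF _ H])
    fix x p y
    assume xpy: "(x, p, y) \<in> set h"
    obtain i where "i < m ^ 3" "x = forecasts m i"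
      using play_hard_env_contexts[OF m h xpy] by auto
    then show "p \<in> grid N \<and> up x = fst x + 1 / (64 * real m) \<and> down x = fst x - 1 / (64 * real m)"
      using play_forecast_in_grid[OF L h xpy] hyp[of i] by (simp add: forecasts_def)
  qed
  finally show ?thesis .
qed

section \<open>Choice of the class and of the block length\<close>

theorem theorem4p7:
  "\<exists>(X :: (real \<times> real \<times> real) set) H (c :: real) (T\<^sub>0 :: nat).
     X \<noteq> {} \<and> H \<subseteq> X \<rightarrow>\<^sub>E {0..1} \<and> card H = 3 \<and> c > 0 \<and>
     (\<forall>T \<ge> T\<^sub>0. \<forall>N \<ge> 1. \<forall>L \<in> learners N.
        (SUP E \<in> environments X. expected_swap_regret N brier H L E T)
          \<ge> c * real T powr (1 / 3))"
proof -
  define X :: "(real \<times> real \<times> real) set" where "X = {0..1} \<times> {0..1} \<times> {0..1}"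
  define f1 f2 f3 where "f1 = restrict (\<lambda>x. fst x) X" and "f2 = restrict (\<lambda>x. fst (snd x)) X"
    and "f3 = restrict (\<lambda>x. snd (snd x)) X"
  define H where "H = {f1, f2, f3}"
  have "(1, 0, 0) \<in> X" "(0, 1, 0) \<in> X" by (auto simp: X_def)
  have "f1 \<noteq> f2" "f1 \<noteq> f3" "f2 \<noteq> f3"
  proof -
    have "f1 (1, 0, 0) \<noteq> f2 (1, 0, 0)" "f1 (1, 0, 0) \<noteq> f3 (1, 0, 0)" "f2 (0, 1, 0) \<noteq> f3 (0, 1, 0)"
      by (auto simp: f1_def f2_def f3_def X_def)
    then show "f1 \<noteq> f2" "f1 \<noteq> f3" "f2 \<noteq> f3" by metis+
  qed
  then have "card H = 3" by (simp add: H_def)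
  moreover have "H \<subseteq> X \<rightarrow>\<^sub>E {0..1}"
    by (auto simp: H_def f1_def f2_def f3_def X_def)
  moreover have "(SUP E \<in> environments X. expected_swap_regret N brier H L E T)
      \<ge> 1 / 32768 * real T powr (1 / 3)" if T: "T \<ge> 64" and L: "L \<in> learners N" for T N L
  proof -
    define r where "r = real T powr (1 / 3)"
    \<comment> \<open>Rounding up gives \<open>T \<le> m ^ 3\<close>, so the rates last for
      \<open>T\<close> rounds, and costs at most a factor 2. \<open>T \<ge> 64\<close> gives
      \<open>m \<ge> 4\<close>, which is \<open>\<eta> \<le> 1 / 8\<close>.\<close>
    define m where "m = nat \<lceil>r\<rceil>"
    have "(64 :: real) powr (1 / 3) \<le> r"
      unfolding r_def using T by (intro powr_mono2) auto
    moreover have "(64 :: real) powr (1 / 3) = 4"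
    proof -
      have "(64 :: real) = 4 powr 3" by simp
      then show ?thesis by (metis powr_powr times_divide_eq_right mult_1_right divide_self
          powr_one zero_neq_numeral zero_le_numeral)
    qed
    ultimately have "4 \<le> r" by simp
    have rm: "r \<le> real m" "real m \<le> 2 * r" and m: "4 \<le> m"
      using \<open>4 \<le> r\<close> unfolding m_def by linarith+
    have r3: "r ^ 3 = real T"
      using T by (simp add: r_def powr_powr flip: powr_realpow)
    have "real T \<le> real (m ^ 3)"
      unfolding r3[symmetric] of_nat_power using rm \<open>4 \<le> r\<close> by (intro power_mono) auto
    then have Tm: "T \<le> m ^ 3" by simp
    have ctx: "forecasts m i \<in> X" if "i < m ^ 3" for i
    proof -
      define d where "d = 1 / (64 * real m)"
      have "0 \<le> d" "d \<le> 1 / 4" using m by (auto simp: d_def field_simps)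
      then show ?thesis
        unfolding X_def forecasts_def d_def[symmetric] using rate_bounds[OF that] by auto
    qed
    have "real T / (8192 * (real m)\<^sup>2)
        \<le> measure_pmf.expectation (play L (hard_env m) T) (potential m N T)"
      by (rule expectation_potential_ge[OF m L Tm])
    also have "\<dots> \<le> expected_swap_regret N brier H L (hard_env m) T"
      unfolding expected_swap_regret_def
    proof (rule integral_mono_AE)
      show "AE h in measure_pmf (play L (hard_env m) T). potential m N T h \<le> swap_regret N brier H h"
        unfolding AE_measure_pmf_iff using m L ctx
        by (intro ballI potential_le_swap_regret[where up = f2 and down = f3])
          (auto simp: H_def f2_def f3_def forecasts_def)
    qed (use finite_play_hard_env[OF L] in \<open>auto intro: integrable_measure_pmf_finite\<close>)
    also have "\<dots> \<le> (SUP E \<in> environments X. expected_swap_regret N brier H L E T)"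
    proof (rule cSUP_upper)
      show "hard_env m \<in> environments X"
        using m by (auto simp: environments_def intro!: ctx)
      show "bdd_above ((\<lambda>E. expected_swap_regret N brier H L E T) ` environments X)"
        using expected_swap_regret_le[OF L, of H]
        by (intro bdd_aboveI2[where M = "real T / 2"]) (simp add: H_def)
    qed
    finally have "real T / (8192 * (real m)\<^sup>2)
      \<le> (SUP E \<in> environments X. expected_swap_regret N brier H L E T)" .
    \<comment> \<open>The constant is \<open>32768 = 4 * 8192\<close>, from
      \<open>m \<le> 2 * r\<close> and \<open>T = r ^ 3\<close>.\<close>
    moreover have "1 / 32768 * r \<le> real T / (8192 * (real m)\<^sup>2)"
    proof -
      have "(real m)\<^sup>2 \<le> (2 * r)\<^sup>2" using rm by (intro power_mono) auto
      then have "r * (real m)\<^sup>2 \<le> r * (2 * r)\<^sup>2" using \<open>4 \<le> r\<close> by (intro mult_left_mono) auto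
      also have "\<dots> = 4 * real T" unfolding r3[symmetric] by (simp add: power2_eq_square power3_eq_cube)
      finally show ?thesis using m by (simp add: field_simps)
    qed
    ultimately show ?thesis by (simp add: r_def)
  qed
  ultimately show ?thesis
    using \<open>(1, 0, 0) \<in> X\<close>
    by (intro exI[of _ X] exI[of _ H] exI[of _ "1 / 32768 :: real"] exI[of _ "64 :: nat"]) auto
qed

end
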